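(* The witnesses $W_N$, $W'_{\mathrm{wer}}$ and $W'_{\mathrm{iso}}$ are all pairwise incomparable with respect to the partial order $\succeq$ on no-go witnesses. That is, $$W_N\not\succeq W'_{\mathrm{wer}},\quad W_N\not\succeq W'_{\mathrm{iso}},\quad W'_{\mathrm{wer}}\not\succeq W_N,\quad W'_{\mathrm{wer}}\not\succeq W'_{\mathrm{iso}},\quad W'_{\mathrm{iso}}\not\succeq W_N,\quad W'_{\mathrm{iso}}\not\succeq W'_{\mathrm{wer}} .$$
   Context: A state is a positive semidefinite operator of trace one. For a Hermitian operator $A$, $A=A_+-A_-$ denotes the unique decomposition with $A_\pm\ge 0$ and $A_+A_-=0$. For an operator $\rho$ on a bipartite system, $\rho^\Gamma$ is the partial transpose with respect to the second subsystem (in the computational basis), and $\rho^{\Gamma_-}=(\rho^\Gamma)_-$. The negativity of a positive semidefinite bipartite operator $\rho$ (not necessarily normalized) is $N(\rho)=\mathrm{Tr}[\rho^{\Gamma_-}]$; in particular $N(\rho^{\Gamma_-})=\mathrm{Tr}[((\rho^{\Gamma_-})^{\Gamma})_-]$, which is $0$ if $\rho^{\Gamma_-}=0$. On $\mathbb{C}^d\otimes\mathbb{C}^d$: $|\Phi\rangle=\frac{1}{\sqrt d}\sum_{j=1}^d|j\rangle\otimes|j\rangle$, and $F=\sum_{i,j=1}^d|ij\rangle\langle ji|$ is the flip operator, with negative part $F_-=\sum_{i<j}|\psi^-_{ij}\rangle\langle\psi^-_{ij}|$, $|\psi^-_{ij}\rangle=\frac{1}{\sqrt2}(|ij\rangle-|ji\rangle)$.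 The witnesses are functions of pairs $(\rho,\sigma)$, where $\rho$ is a state of a bipartite system $\mathbb{C}^m\otimes\mathbb{C}^m$ and $\sigma$ is a state of a bipartite system $\mathbb{C}^d\otimes\mathbb{C}^d$, with $m,d\ge2$ arbitrary: $$W_N(\rho,\sigma)=N(\rho)-N(\sigma),$$ $$W'_{\mathrm{wer}}(\rho,\sigma)=\frac{d\,N(\rho^{\Gamma_-})+N(\rho)}{2}-\mathrm{Tr}[F_-\sigma^{\Gamma_-}],$$ $$W'_{\mathrm{iso}}(\rho,\sigma)=\frac{2N(\rho^{\Gamma_-})+N(\rho)}{d}-\langle\Phi|\sigma^{\Gamma_-}|\Phi\rangle .$$ For two such functions, $W_1\succeq W_2$ means: for all pairs $(\rho,\sigma)$ (of all dimensions), $W_2(\rho,\sigma)<0$ implies $W_1(\rho,\sigma)<0$. *)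

theory Defs
  imports "Jordan_Normal_Form.Matrix"
begin

text \<open>
  Operators on \<open>\<complex>\<^sup>n\<close> are complex \<open>n \<times> n\<close> matrices. For the bipartite space
  \<open>\<complex>\<^sup>n \<otimes> \<complex>\<^sup>n\<close> the dimension is \<open>n * n\<close> and the product basis vector
  \<open>|i\<rangle> \<otimes> |j\<rangle>\<close> (with \<open>i, j < n\<close>, counted from 0) has index \<open>i * n + j\<close>, so that
  an index \<open>r\<close> stands for the pair \<open>(r div n, r mod n)\<close>.
\<close>

definition mat_trace :: "complex mat \<Rightarrow> complex" where
  "mat_trace A = (\<Sum>i<dim_row A. A $$ (i, i))"

text \<open>
  In the order on \<open>complex\<close>, \<open>0 \<le> z\<close> means that \<open>z\<close> is real and nonnegative; over the complex
  field this forces \<open>A\<close> to be Hermitian.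
\<close>

definition psd :: "nat \<Rightarrow> complex mat \<Rightarrow> bool" where
  "psd n A \<longleftrightarrow> A \<in> carrier_mat n n \<and> (\<forall>v \<in> carrier_vec n. 0 \<le> (A *\<^sub>v v) \<bullet>c v)"

definition state :: "nat \<Rightarrow> complex mat \<Rightarrow> bool" where
  "state n A \<longleftrightarrow> psd n A \<and> mat_trace A = 1"

text \<open>
  The component \<open>A\<^sub>-\<close> of the decomposition \<open>A = A\<^sub>+ - A\<^sub>-\<close>, \<open>A\<^sub>\<plusminus> \<ge> 0\<close>,
  \<open>A\<^sub>+ A\<^sub>- = 0\<close>, which exists and is unique for Hermitian \<open>A\<close>. The value is meaningful for
  such \<open>A\<close> only.
\<close>

definition neg_part :: "complex mat \<Rightarrow> complex mat" where
  "neg_part A = (THE B. \<exists>P. psd (dim_row A) P \<and> psd (dim_row A) B \<and>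
     P * B = 0\<^sub>m (dim_row A) (dim_row A) \<and> A = P - B)"

text \<open>Transposition of the second tensor factor of \<open>\<complex>\<^sup>n \<otimes> \<complex>\<^sup>n\<close>:
  \<open>\<langle>ij|A\<^sup>\<Gamma>|kl\<rangle> = \<langle>il|A|kj\<rangle>\<close>.\<close>

definition partial_transpose :: "nat \<Rightarrow> complex mat \<Rightarrow> complex mat" where
  "partial_transpose n A = mat (n * n) (n * n)
     (\<lambda>(r, c). A $$ ((r div n) * n + c mod n, (c div n) * n + r mod n))"

definition pt_neg :: "nat \<Rightarrow> complex mat \<Rightarrow> complex mat" where
  "pt_neg n A = neg_part (partial_transpose n A)"

definition negativity :: "nat \<Rightarrow> complex mat \<Rightarrow> real" where
  "negativity n A = Re (mat_trace (pt_neg n A))"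

definition ket :: "nat \<Rightarrow> nat \<Rightarrow> nat \<Rightarrow> complex vec" where
  "ket d i j = unit_vec (d * d) (i * d + j)"

definition max_ent :: "nat \<Rightarrow> complex vec" where
  "max_ent d = vec (d * d) (\<lambda>r. complex_of_real (1 / sqrt (real d)) * (\<Sum>j<d. ket d j j $ r))"

definition psi_minus :: "nat \<Rightarrow> nat \<Rightarrow> nat \<Rightarrow> complex vec" where
  "psi_minus d i j = complex_of_real (1 / sqrt 2) \<cdot>\<^sub>v (ket d i j - ket d j i)"

text \<open>\<open>F\<^sub>- = \<Sum>\<^bsub>i<j\<^esub> |\<psi>\<^sup>-\<^sub>i\<^sub>j\<rangle>\<langle>\<psi>\<^sup>-\<^sub>i\<^sub>j|\<close>, the negative part of the flip operator
  \<open>F = \<Sum>\<^bsub>i,j\<^esub> |ij\<rangle>\<langle>ji|\<close>, given by its entries.\<close>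

definition flip_neg :: "nat \<Rightarrow> complex mat" where
  "flip_neg d = mat (d * d) (d * d)
     (\<lambda>(r, c). \<Sum>j<d. \<Sum>i<j. psi_minus d i j $ r * cnj (psi_minus d i j $ c))"

text \<open>
  A witness is applied to \<open>m\<close>, \<open>d\<close>, \<open>\<rho>\<close> and \<open>\<sigma>\<close>, where \<open>\<rho>\<close> acts on
  \<open>\<complex>\<^sup>m \<otimes> \<complex>\<^sup>m\<close> and \<open>\<sigma>\<close> on \<open>\<complex>\<^sup>d \<otimes> \<complex>\<^sup>d\<close>. The complex numbers
  whose real parts are taken are real, because all operators involved are Hermitian.
\<close>

type_synonym witness = "nat \<Rightarrow> nat \<Rightarrow> complex mat \<Rightarrow> complex mat \<Rightarrow> real"

definition W_N :: witness where
  "W_N m d \<rho> \<sigma> = negativity m \<rho> - negativity d \<sigma>"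

definition W_wer :: witness where
  "W_wer m d \<rho> \<sigma> =
     (real d * negativity m (pt_neg m \<rho>) + negativity m \<rho>) / 2
     - Re (mat_trace (flip_neg d * pt_neg d \<sigma>))"

definition W_iso :: witness where
  "W_iso m d \<rho> \<sigma> =
     (2 * negativity m (pt_neg m \<rho>) + negativity m \<rho>) / real d
     - Re ((pt_neg d \<sigma> *\<^sub>v max_ent d) \<bullet>c max_ent d)"

text \<open>\<open>dominates W1 W2\<close> is \<open>W\<^sub>1 \<succeq> W\<^sub>2\<close>.\<close>

definition dominates :: "witness \<Rightarrow> witness \<Rightarrow> bool" where
  "dominates W1 W2 \<longleftrightarrow>
     (\<forall>m d \<rho> \<sigma>. 2 \<le> m \<longrightarrow> 2 \<le> d \<longrightarrow> state (m * m) \<rho> \<longrightarrow> state (d * d) \<sigma> \<longrightarrow>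
        W2 m d \<rho> \<sigma> < 0 \<longrightarrow> W1 m d \<rho> \<sigma> < 0)"

end

theory Submission
  imports Defs
begin

text \<open>
  All six non-implications are witnessed on two qubits. Write \<open>a = N(\<rho>)\<close>,
  \<open>b = N(\<rho>\<^sup>\<Gamma>\<^sup>-)\<close>. With \<open>p = 2/7\<close> the states
  \<open>p |\<Phi>\<rangle>\<langle>\<Phi>| + (1 - p) |00\<rangle>\<langle>00|\<close> and
  \<open>p |\<psi>\<^sup>-\<rangle>\<langle>\<psi>\<^sup>-| + (1 - p) |01\<rangle>\<langle>01|\<close> have
  \<open>\<sigma>\<^sup>\<Gamma>\<^sup>- = |\<psi>\<^sup>-\<rangle>\<langle>\<psi>\<^sup>-|/7\<close> and
  \<open>\<sigma>\<^sup>\<Gamma>\<^sup>- = |\<Phi>\<rangle>\<langle>\<Phi>|/7\<close> respectively. Both have negativity \<open>1/7\<close>, but the first is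
  seen only by the overlap with \<open>F\<^sub>-\<close> and the second only by the overlap with \<open>\<Phi>\<close>.
  Pairing them with a product state, for which \<open>a = b = 0\<close>, shows that neither
  \<open>W'\<close> dominates the other one or \<open>W\<^sub>N\<close>. Against domination by \<open>W\<^sub>N\<close> take
  \<open>\<rho> = (4/7) |\<Phi>\<rangle>\<langle>\<Phi>| + (3/7) |01\<rangle>\<langle>01|\<close>: the negative eigenvector of \<open>\<rho>\<^sup>\<Gamma>\<close>
  is not maximally entangled, so \<open>a = 1/7\<close> but \<open>b = 2/35 < a/2\<close>, and therefore
  \<open>(2 b + a)/2 < 1/7 = a\<close>.
\<close>

section \<open>Uniqueness of the negative part\<close>

definition adj :: "complex mat \<Rightarrow> complex mat" where
  "adj A = mat (dim_col A) (dim_row A) (\<lambda>(i, j). cnj (A $$ (j, i)))"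

lemma adj_carrier [simp]: "A \<in> carrier_mat n m \<Longrightarrow> adj A \<in> carrier_mat m n"
  by (simp add: adj_def)

lemma adj_mult:
  assumes "A \<in> carrier_mat n m" "B \<in> carrier_mat m k"
  shows "adj (A * B) = adj B * adj A"
  using assms by (intro eq_matI) (auto simp: adj_def scalar_prod_def mult.commute)

lemma adj_minus:
  "A \<in> carrier_mat n m \<Longrightarrow> B \<in> carrier_mat n m \<Longrightarrow> adj (A - B) = adj A - adj B"
  by (intro eq_matI) (auto simp: adj_def)

lemma adj_zero [simp]: "adj (0\<^sub>m n m) = 0\<^sub>m m n"
  by (intro eq_matI) (auto simp: adj_def)

lemma mult_mat_vec_cscalar_prod:
  fixes A :: "complex mat"
  assumes "A \<in> carrier_mat n n" "v \<in> carrier_vec n" "w \<in> carrier_vec n"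
  shows "(A *\<^sub>v v) \<bullet>c w = (\<Sum>i<n. \<Sum>j<n. A $$ (i, j) * v $ j * cnj (w $ i))"
  using assms by (auto simp: scalar_prod_def sum_distrib_right atLeast0LessThan intro!: sum.cong)

lemma cscalar_prod_mult_mat_vec:
  fixes A :: "complex mat"
  assumes "A \<in> carrier_mat n n" "v \<in> carrier_vec n" "w \<in> carrier_vec n"
  shows "v \<bullet>c (A *\<^sub>v w) = (adj A *\<^sub>v v) \<bullet>c w"
proof -
  have "v \<bullet>c (A *\<^sub>v w) = (\<Sum>i<n. \<Sum>j<n. v $ i * cnj (A $$ (i, j)) * cnj (w $ j))"
    using assms
    by (auto simp: scalar_prod_def sum_distrib_left atLeast0LessThan mult.assoc intro!: sum.cong)
  also have "\<dots> = (\<Sum>j<n. \<Sum>i<n. v $ i * cnj (A $$ (i, j)) * cnj (w $ j))"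
    by (rule sum.swap)
  also have "\<dots> = (adj A *\<^sub>v v) \<bullet>c w"
    using assms by (auto simp: mult_mat_vec_cscalar_prod[of _ n] adj_def mult_ac intro!: sum.cong)
  finally show ?thesis .
qed

lemma mat_trace_comm:
  assumes "A \<in> carrier_mat n n" "B \<in> carrier_mat n n"
  shows "mat_trace (A * B) = mat_trace (B * A)"
proof -
  have "mat_trace (A * B) = (\<Sum>i<n. \<Sum>j<n. A $$ (i, j) * B $$ (j, i))"
    using assms by (auto simp: mat_trace_def scalar_prod_def atLeast0LessThan)
  also have "\<dots> = (\<Sum>j<n. \<Sum>i<n. A $$ (i, j) * B $$ (j, i))"
    by (rule sum.swap)
  also have "\<dots> = mat_trace (B * A)"
    using assms by (auto simp: mat_trace_def scalar_prod_def atLeast0LessThan mult.commute)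
  finally show ?thesis .
qed

section \<open>Entries of positive semidefinite matrices\<close>

lemma psd_carrier: "psd n A \<Longrightarrow> A \<in> carrier_mat n n"
  by (simp add: psd_def)

lemma psd_two_entries:
  assumes "psd n A" "i < n" "j < n"
  shows "0 \<le> A $$ (i, i) * a * cnj a + A $$ (i, j) * b * cnj a
           + A $$ (j, i) * a * cnj b + A $$ (j, j) * b * cnj b"
proof -
  \<comment> \<open>This is \<open>a\<close> times the \<open>i\<close>-th basis vector plus
    \<open>b\<close> times the \<open>j\<close>-th. Written as a sum, it also covers
    \<open>i = j\<close>.\<close>
  define v where "v = vec n (\<lambda>k. (if k = i then a else 0) + (if k = j then b else 0))"
  have v: "v \<in> carrier_vec n" by (simp add: v_def)
  have inner: "(\<Sum>l<n. A $$ (k, l) * v $ l * cnj (v $ k))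
      = (A $$ (k, i) * a + A $$ (k, j) * b) * cnj (v $ k)" for k
  proof -
    have "(\<Sum>l<n. A $$ (k, l) * v $ l) = (\<Sum>l<n. (if l = i then A $$ (k, l) * a else 0)
        + (if l = j then A $$ (k, l) * b else 0))"
      by (intro sum.cong) (auto simp: v_def algebra_simps)
    also have "\<dots> = A $$ (k, i) * a + A $$ (k, j) * b"
      using assms by (simp add: sum.distrib)
    finally show ?thesis by (simp add: sum_distrib_right [symmetric])
  qed
  have "(A *\<^sub>v v) \<bullet>c v = (\<Sum>k<n. (A $$ (k, i) * a + A $$ (k, j) * b) * cnj (v $ k))"
    using psd_carrier[OF assms(1)] v by (simp add: mult_mat_vec_cscalar_prod inner)
  also have "\<dots> = (\<Sum>k<n. (if k = i then (A $$ (k, i) * a + A $$ (k, j) * b) * cnj a else 0)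
        + (if k = j then (A $$ (k, i) * a + A $$ (k, j) * b) * cnj b else 0))"
    by (intro sum.cong) (auto simp: v_def algebra_simps)
  also have "\<dots> = (A $$ (i, i) * a + A $$ (i, j) * b) * cnj a
        + (A $$ (j, i) * a + A $$ (j, j) * b) * cnj b"
    using assms by (simp add: sum.distrib)
  finally have form: "(A *\<^sub>v v) \<bullet>c v = \<dots>" .
  have "0 \<le> (A *\<^sub>v v) \<bullet>c v"
    using assms(1) v by (simp add: psd_def)
  then show ?thesis
    by (simp only: form distrib_right add.assoc)
qed

lemma psd_hermitian:
  assumes "psd n A"
  shows "adj A = A"
proof -
  have "cnj (A $$ (j, i)) = A $$ (i, j)" if "i < n" "j < n" for i j
    \<comment> \<open>Polarization: the first two values make the diagonal real; realness at (1, 1)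
      and (1, \<i>) then equates, up to sign, the imaginary and the real parts of
      \<open>A $$ (i, j)\<close> and \<open>A $$ (j, i)\<close>.\<close>
    using psd_two_entries[OF assms that, of 1 0] psd_two_entries[OF assms that, of 0 1]
      psd_two_entries[OF assms that, of 1 1] psd_two_entries[OF assms that, of 1 \<i>]
    by (auto simp: complex_eq_iff less_eq_complex_def)
  with psd_carrier[OF assms] show ?thesis
    by (intro eq_matI) (auto simp: adj_def)
qed

lemma psd_trace_zero:
  assumes "psd n A" "mat_trace A = 0"
  shows "A = 0\<^sub>m n n"
proof -
  note A = psd_carrier[OF assms(1)]
  have nonneg: "0 \<le> A $$ (i, i)" if "i < n" for i
    using psd_two_entries[OF assms(1) that that, of 1 0] by simp
  have diag: "A $$ (i, i) = 0" if "i < n" for i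
  proof -
    have "\<forall>i\<in>{..<n}. A $$ (i, i) = 0"
      using assms(2) A nonneg by (subst sum_nonneg_eq_0_iff [symmetric]) (auto simp: mat_trace_def)
    with that show ?thesis by simp
  qed
  have "A $$ (i, j) = 0" if ij: "i < n" "j < n" for i j
  proof -
    define z where "z = A $$ (i, j)"
    have "A $$ (j, i) = cnj z"
      unfolding z_def using psd_hermitian[OF assms(1)] A ij
      by (metis (mono_tags, lifting) adj_def carrier_matD index_mat(1) old.prod.case)
    \<comment> \<open>With zero diagonal entries, the coefficient \<open>- cnj z\<close> turns the
      form into -2|z|^2.\<close>
    then have "0 \<le> - (z * cnj z) - z * cnj z"
      using psd_two_entries[OF assms(1) ij, of 1 "- cnj z"] diag ij
      by (simp add: z_def [symmetric] mult.commute)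
    then have "(cmod z)\<^sup>2 \<le> 0"
      by (simp add: less_eq_complex_def complex_mult_cnj cmod_power2)
    then show ?thesis by (simp add: z_def)
  qed
  then show ?thesis using A by (intro eq_matI) auto
qed

lemma psd_add:
  assumes "psd n A" "psd n B"
  shows "psd n (A + B)"
  unfolding psd_def
proof (intro conjI ballI)
  note c = psd_carrier[OF assms(1)] psd_carrier[OF assms(2)]
  then show "A + B \<in> carrier_mat n n" by simp
  fix v :: "complex vec" assume v: "v \<in> carrier_vec n"
  have "((A + B) *\<^sub>v v) \<bullet>c v = (A *\<^sub>v v) \<bullet>c v + (B *\<^sub>v v) \<bullet>c v"
    using c v by (simp add: add_mult_distrib_mat_vec[of _ n n] add_scalar_prod_distrib[of _ n])
  then show "0 \<le> ((A + B) *\<^sub>v v) \<bullet>c v"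
    using assms v by (simp add: psd_def)
qed

lemma psd_sandwich:
  assumes "psd n S" "D \<in> carrier_mat n n" "adj D = D"
  shows "psd n (D * S * D)"
  unfolding psd_def
proof (intro conjI ballI)
  note S = psd_carrier[OF assms(1)]
  show "D * S * D \<in> carrier_mat n n" using S assms by simp
  fix v :: "complex vec" assume v: "v \<in> carrier_vec n"
  have Dv: "D *\<^sub>v v \<in> carrier_vec n" "S *\<^sub>v (D *\<^sub>v v) \<in> carrier_vec n"
    using assms(2) S v by auto
  have "D * S * D *\<^sub>v v = D *\<^sub>v (S *\<^sub>v (D *\<^sub>v v))"
    using assms(2) S v Dv by (simp add: assoc_mult_mat_vec[of _ n n _ n])
  then have "(D * S * D *\<^sub>v v) \<bullet>c v = (S *\<^sub>v (D *\<^sub>v v)) \<bullet>c (D *\<^sub>v v)"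
    using cscalar_prod_mult_mat_vec[OF assms(2) Dv(2) v] assms(3) by simp
  then show "0 \<le> (D * S * D *\<^sub>v v) \<bullet>c v"
    using assms(1) Dv by (simp add: psd_def)
qed

section \<open>Uniqueness of the positive square root\<close>

lemma hermitian_square_zero:
  assumes "D \<in> carrier_mat n n" "adj D = D" "D * D = 0\<^sub>m n n"
  shows "D = 0\<^sub>m n n"
proof -
  have herm: "cnj (D $$ (i, j)) = D $$ (j, i)" if "i < n" "j < n" for i j
    using assms(1,2) that
    by (metis (mono_tags, lifting) adj_def carrier_matD index_mat(1) old.prod.case)
  have "D $$ (i, j) = 0" if ij: "i < n" "j < n" for i j
  proof -
    have entry: "D $$ (i, k) * D $$ (k, i) = complex_of_real ((cmod (D $$ (i, k)))\<^sup>2)" if "k < n" for k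
      by (simp only: complex_norm_square herm[OF ij(1) that])
    \<comment> \<open>A diagonal entry of \<open>D * D\<close> is the squared norm of a row of
      \<open>D\<close>.\<close>
    have "0 = (D * D) $$ (i, i)" using assms(3) ij by simp
    also have "\<dots> = (\<Sum>k<n. D $$ (i, k) * D $$ (k, i))"
      using assms(1) ij by (auto simp: scalar_prod_def atLeast0LessThan)
    also have "\<dots> = (\<Sum>k<n. complex_of_real ((cmod (D $$ (i, k)))\<^sup>2))"
      using ij herm by (intro sum.cong) (auto simp: entry)
    finally have "(\<Sum>k<n. (cmod (D $$ (i, k)))\<^sup>2) = 0"
      by (metis of_real_eq_0_iff of_real_sum)
    with ij show ?thesis by (auto simp: sum_nonneg_eq_0_iff)
  qed
  with assms(1) show ?thesis by (intro eq_matI) auto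
qed

text \<open>
  With \<open>D = S - T\<close> the hypothesis reads \<open>S D = - D T\<close>, so
  \<open>Tr (D S D) = Tr (S D D) = - Tr (D T D)\<close>. Both outer traces are nonnegative, hence
  \<open>D S D = D T D = 0\<close> and \<open>D\<^sup>3 = 0\<close>.
\<close>

lemma psd_sqrt_unique:
  assumes S: "psd n S" and T: "psd n T" and eq: "S * S = T * T"
  shows "S = T"
proof -
  note c [simp] = psd_carrier[OF S] psd_carrier[OF T]
  note dims [simp] = carrier_matD[OF c(1)] carrier_matD[OF c(2)]
  define D where "D = S - T"
  have D [simp]: "D \<in> carrier_mat n n" unfolding D_def by (rule minus_carrier_mat[OF c(2)])
  have hD: "adj D = D"
    using psd_hermitian[OF S] psd_hermitian[OF T] by (simp add: D_def adj_minus[of _ n n])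
  have pS: "psd n (D * S * D)" and pT: "psd n (D * T * D)"
    using S T hD by (auto intro: psd_sandwich)
  have SD: "S * D = - (D * T)"
  proof -
    have "S * D = S * S - S * T"
      unfolding D_def by (rule mult_minus_distrib_mat[of _ n n _ n]) auto
    moreover have "D * T = S * T - T * T"
      unfolding D_def by (rule minus_mult_distrib_mat[of _ n n _ _ n]) auto
    ultimately show ?thesis using eq by (auto intro!: eq_matI simp del: index_mult_mat(1))
  qed
  have "mat_trace (D * S * D) = mat_trace (D * (S * D))"
    by (simp add: assoc_mult_mat[of _ n n _ n _ n])
  also have "\<dots> = mat_trace ((S * D) * D)"
    by (rule mat_trace_comm[OF D mult_carrier_mat[OF c(1) D]])
  also have "\<dots> = - mat_trace (D * T * D)"
    unfolding SD using carrier_matD[OF D] by (simp add: mat_trace_def sum_negf)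
  finally have tr: "mat_trace (D * S * D) = - mat_trace (D * T * D)" .
  have nonneg: "0 \<le> mat_trace X" if "psd n X" for X
    using psd_two_entries[OF that, of _ _ 1 0] psd_carrier[OF that]
    by (auto simp: mat_trace_def intro!: sum_nonneg)
  have "mat_trace (D * T * D) = 0"
    using nonneg[OF pS] nonneg[OF pT] tr by (simp add: less_eq_complex_def complex_eq_iff)
  then have "D * S * D = 0\<^sub>m n n" "D * T * D = 0\<^sub>m n n"
    using tr pS pT by (auto intro: psd_trace_zero)
  moreover have "D * D * D = D * S * D - D * T * D"
  proof -
    have "D * D = D * S - D * T"
      by (subst (2) D_def, rule mult_minus_distrib_mat[of _ n n _ n]) auto
    then show ?thesis
      by (simp add: minus_mult_distrib_mat[OF mult_carrier_mat[OF D c(1)] mult_carrier_mat[OF D c(2)] D])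
  qed
  ultimately have "D * D * D = 0\<^sub>m n n" by (auto intro!: eq_matI)
  \<comment> \<open>Both \<open>D * D\<close> and \<open>D\<close> are Hermitian, so D^4 = 0
    descends to D^2 = 0 and then to D = 0.\<close>
  then have "(D * D) * (D * D) = 0\<^sub>m n n"
    by (simp add: assoc_mult_mat[OF mult_carrier_mat[OF D D] D D, symmetric] left_mult_zero_mat[OF D])
  then have "D * D = 0\<^sub>m n n"
    by (rule hermitian_square_zero[OF mult_carrier_mat[OF D D], rotated])
      (simp add: adj_mult[OF D D] hD)
  then have "D = 0\<^sub>m n n" by (rule hermitian_square_zero[OF D hD])
  then have "S $$ (i, j) - T $$ (i, j) = 0" if "i < n" "j < n" for i j
    using c that unfolding D_def
    by (metis carrier_matD index_minus_mat(1) index_zero_mat(1))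
  then show ?thesis using c by (intro eq_matI) auto
qed

text \<open>Taking adjoints of \<open>P * B = 0\<close> gives \<open>B * P = 0\<close>, so all cross
  terms vanish.\<close>

lemma square_sum_eq_square_diff:
  assumes P: "psd n P" and B: "psd n B" and PB: "P * B = 0\<^sub>m n n"
  shows "(P + B) * (P + B) = (P - B) * (P - B)"
proof -
  note c [simp] = psd_carrier[OF P] psd_carrier[OF B]
  note dims [simp] = carrier_matD[OF c(1)] carrier_matD[OF c(2)]
  have BP: "B * P = 0\<^sub>m n n"
    using adj_mult[OF c(1) c(2)] PB psd_hermitian[OF P] psd_hermitian[OF B] by simp
  have "(P + B) * (P + B) = P * P + B * B"
    by (simp add: add_mult_distrib_mat[of _ n n _ _ n] mult_add_distrib_mat[of _ n n _ n] PB BP)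
      (auto intro!: eq_matI)
  moreover have "(P - B) * (P - B) = P * P + B * B"
    by (simp add: minus_carrier_mat[OF c(2)] minus_mult_distrib_mat[of _ n n _ _ n] mult_minus_distrib_mat[of _ n n _ n] PB BP)
      (auto intro!: eq_matI)
  ultimately show ?thesis by simp
qed

text \<open>\<open>P + B\<close> is the positive square root of \<open>(P - B)\<^sup>2\<close>.\<close>

lemma neg_part_eqI:
  assumes P: "psd n P" and B: "psd n B" and PB: "P * B = 0\<^sub>m n n" and A: "A = P - B"
  shows "neg_part A = B"
proof -
  note c = psd_carrier[OF P] psd_carrier[OF B]
  have dim: "dim_row A = n" using A c by simp
  show ?thesis unfolding neg_part_def dim
  proof (rule the_equality)
    show "\<exists>P. psd n P \<and> psd n B \<and> P * B = 0\<^sub>m n n \<and> A = P - B"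
      using assms by blast
    fix C assume "\<exists>P. psd n P \<and> psd n C \<and> P * C = 0\<^sub>m n n \<and> A = P - C"
    then obtain Q where Q: "psd n Q" and C: "psd n C" and QC: "Q * C = 0\<^sub>m n n" and A': "A = Q - C"
      by blast
    note c' = psd_carrier[OF Q] psd_carrier[OF C]
    have sum_eq: "P + B = Q + C"
      using square_sum_eq_square_diff[OF P B PB] square_sum_eq_square_diff[OF Q C QC] A A'
      by (intro psd_sqrt_unique[OF psd_add[OF P B] psd_add[OF Q C]]) simp
    show "C = B"
    proof (rule eq_matI)
      fix i j assume "i < dim_row B" "j < dim_col B"
      then have ij: "i < n" "j < n" using c by auto
      have "P $$ (i, j) + B $$ (i, j) = Q $$ (i, j) + C $$ (i, j)"
        using arg_cong[OF sum_eq, of "\<lambda>M. M $$ (i, j)"] c c' ij by simp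
      moreover have "P $$ (i, j) - B $$ (i, j) = Q $$ (i, j) - C $$ (i, j)"
        using arg_cong[OF trans[OF A[symmetric] A'], of "\<lambda>M. M $$ (i, j)"] c c' ij by simp
      ultimately show "C $$ (i, j) = B $$ (i, j)" by (simp add: complex_eq_iff)
    qed (use c c' in auto)
  qed
qed

section \<open>Two-qubit X-matrices\<close>

text \<open>Diagonal \<open>a, b, c, d\<close>, entry \<open>x\<close> coupling \<open>|01\<rangle>\<close> with \<open>|10\<rangle>\<close> and
  \<open>y\<close> coupling \<open>|00\<rangle>\<close> with \<open>|11\<rangle>\<close>; the partial transpose exchanges \<open>x\<close> and \<open>y\<close>.\<close>

definition xmat :: "real \<Rightarrow> real \<Rightarrow> real \<Rightarrow> real \<Rightarrow> real \<Rightarrow> real \<Rightarrow> complex mat" where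
  "xmat a b c d x y = mat 4 4 (\<lambda>(i, j). complex_of_real (
     if i = j then [a, b, c, d] ! i
     else if i + j = 3 then (if i = 1 \<or> i = 2 then x else y) else 0))"

lemma xmat_carrier [simp]: "xmat a b c d x y \<in> carrier_mat 4 4"
  by (simp add: xmat_def)

lemma xmat_index [simp]:
  "xmat a b c d x y $$ (0, 0) = a" "xmat a b c d x y $$ (Suc 0, Suc 0) = b"
  "xmat a b c d x y $$ (2, 2) = c" "xmat a b c d x y $$ (3, 3) = d"
  "xmat a b c d x y $$ (Suc 0, 2) = x" "xmat a b c d x y $$ (2, Suc 0) = x"
  "xmat a b c d x y $$ (0, 3) = y" "xmat a b c d x y $$ (3, 0) = y"
  "xmat a b c d x y $$ (0, Suc 0) = 0" "xmat a b c d x y $$ (Suc 0, 0) = 0"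
  "xmat a b c d x y $$ (0, 2) = 0" "xmat a b c d x y $$ (2, 0) = 0"
  "xmat a b c d x y $$ (3, Suc 0) = 0" "xmat a b c d x y $$ (Suc 0, 3) = 0"
  "xmat a b c d x y $$ (3, 2) = 0" "xmat a b c d x y $$ (2, 3) = 0"
  by (simp_all add: xmat_def)

lemma dim_xmat [simp]: "dim_row (xmat a b c d x y) = 4" "dim_col (xmat a b c d x y) = 4"
  by (simp_all add: xmat_def)

lemma sum_lessThan_4: "(\<Sum>i<4. f i) = f 0 + f (Suc 0) + f 2 + f (3::nat)"
  by (simp add: numeral_eq_Suc)

lemma eq_mat_4I:
  assumes "A \<in> carrier_mat 4 4" "B \<in> carrier_mat 4 4"
    and "\<And>i j. i \<in> {0, Suc 0, 2, 3} \<Longrightarrow> j \<in> {0, Suc 0, 2, 3} \<Longrightarrow> A $$ (i, j) = B $$ (i, j)"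
  shows "A = B"
proof (rule eq_matI)
  fix i j assume "i < dim_row B" "j < dim_col B"
  with assms(2) have "i \<in> {0, Suc 0, 2, 3}" "j \<in> {0, Suc 0, 2, 3}" by auto
  then show "A $$ (i, j) = B $$ (i, j)" by (rule assms(3))
qed (use assms in auto)

lemma trace_xmat: "mat_trace (xmat a b c d x y) = complex_of_real (a + b + c + d)"
  by (simp add: mat_trace_def sum_lessThan_4)

lemma xmat_minus:
  "xmat a b c d x y - xmat a' b' c' d' x' y'
     = xmat (a - a') (b - b') (c - c') (d - d') (x - x') (y - y')"
  by (rule eq_mat_4I) auto

lemma partial_transpose_xmat: "partial_transpose 2 (xmat a b c d x y) = xmat a b c d y x"
  by (rule eq_mat_4I) (auto simp: partial_transpose_def simp flip: numeral_2_eq_2 numeral_3_eq_3)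

text \<open>The cross term is at most 2 sqrt(ab) |u||v| in modulus, which the arithmetic-geometric
  mean inequality bounds by the diagonal terms.\<close>

lemma binary_form_nonneg:
  fixes a b x :: real and u v :: complex
  assumes "0 \<le> a" "0 \<le> b" "x\<^sup>2 \<le> a * b"
  shows "0 \<le> a * (cmod u)\<^sup>2 + b * (cmod v)\<^sup>2 + 2 * x * Re (u * cnj v)"
proof -
  have "\<bar>x\<bar> \<le> sqrt a * sqrt b"
    using assms by (metis real_sqrt_abs real_sqrt_le_mono real_sqrt_mult)
  moreover have "\<bar>Re (u * cnj v)\<bar> \<le> cmod u * cmod v"
    by (metis abs_Re_le_cmod complex_mod_cnj norm_mult)
  ultimately have "\<bar>x * Re (u * cnj v)\<bar> \<le> (sqrt a * sqrt b) * (cmod u * cmod v)"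
    unfolding abs_mult by (intro mult_mono) auto
  moreover have "2 * ((sqrt a * sqrt b) * (cmod u * cmod v)) \<le> a * (cmod u)\<^sup>2 + b * (cmod v)\<^sup>2"
    using assms zero_le_power2[of "sqrt a * cmod u - sqrt b * cmod v"]
    by (simp add: power2_diff power_mult_distrib mult_ac)
  moreover have "- (x * Re (u * cnj v)) \<le> \<bar>x * Re (u * cnj v)\<bar>" by simp
  ultimately have "0 \<le> a * (cmod u)\<^sup>2 + b * (cmod v)\<^sup>2 + 2 * (x * Re (u * cnj v))" by linarith
  then show ?thesis by (simp only: mult.assoc)
qed

text \<open>The form splits into the 2x2 blocks on |00>, |11> and on |01>, |10>.\<close>

lemma psd_xmat:
  assumes "0 \<le> a" "0 \<le> b" "0 \<le> c" "0 \<le> d" "x\<^sup>2 \<le> b * c" "y\<^sup>2 \<le> a * d"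
  shows "psd 4 (xmat a b c d x y)"
  unfolding psd_def
proof (intro conjI ballI)
  fix v :: "complex vec" assume v: "v \<in> carrier_vec 4"
  have "(xmat a b c d x y *\<^sub>v v) \<bullet>c v
      = complex_of_real (a * (cmod (v $ 0))\<^sup>2 + d * (cmod (v $ 3))\<^sup>2 + 2 * y * Re (v $ 0 * cnj (v $ 3)))
      + complex_of_real (b * (cmod (v $ 1))\<^sup>2 + c * (cmod (v $ 2))\<^sup>2 + 2 * x * Re (v $ 1 * cnj (v $ 2)))"
    unfolding mult_mat_vec_cscalar_prod[OF xmat_carrier v v]
    by (simp add: sum_lessThan_4 complex_eq_iff cmod_def power2_eq_square algebra_simps)
  then show "0 \<le> (xmat a b c d x y *\<^sub>v v) \<bullet>c v"
    using binary_form_nonneg[OF assms(1,4,6)] binary_form_nonneg[OF assms(2,3,5)]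
    by (simp add: less_eq_complex_def)
qed simp

text \<open>The primed matrix is the candidate negative part. The last eight equations are the
  entries of the two blocks of the product that must vanish.\<close>

lemma pt_neg_xmat:
  assumes "A = xmat (a - a') (b - b') (c - c') (d - d') (y - y') (x - x')"
    and "0 \<le> a" "0 \<le> b" "0 \<le> c" "0 \<le> d" "x\<^sup>2 \<le> b * c" "y\<^sup>2 \<le> a * d"
    and "0 \<le> a'" "0 \<le> b'" "0 \<le> c'" "0 \<le> d'" "x'\<^sup>2 \<le> b' * c'" "y'\<^sup>2 \<le> a' * d'"
    and "a * a' + y * y' = 0" "a * y' + y * d' = 0" "y * a' + d * y' = 0" "y * y' + d * d' = 0"
    and "b * b' + x * x' = 0" "b * x' + x * c' = 0" "x * b' + c * x' = 0" "x * x' + c * c' = 0"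
  shows "pt_neg 2 A = xmat a' b' c' d' x' y'"
  unfolding pt_neg_def assms(1) partial_transpose_xmat
proof (rule neg_part_eqI)
  show "psd 4 (xmat a b c d x y)" "psd 4 (xmat a' b' c' d' x' y')"
    using assms by (auto intro!: psd_xmat)
  \<comment> \<open>Gathers each product entry into a single real expression, to which the assumed
    equations apply.\<close>
  have [simp]: "complex_of_real p * of_real q + of_real r * of_real s = of_real (p * q + r * s)" for p q r s
    by simp
  show "xmat a b c d x y * xmat a' b' c' d' x' y' = 0\<^sub>m 4 4"
    by (rule eq_mat_4I)
      (auto simp: scalar_prod_def atLeast0LessThan sum_lessThan_4 assms
        simp del: of_real_add of_real_mult)
qed (simp add: xmat_minus)

section \<open>The witnesses\<close>

lemma flip_neg_2: "flip_neg 2 = xmat 0 (1/2) (1/2) 0 (-1/2) 0"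
proof -
  have *: "complex_of_real (sqrt 2) * complex_of_real (sqrt 2) = 2"
    by (metis of_real_mult of_real_numeral real_sqrt_mult_self abs_numeral)
  show ?thesis
    by (rule eq_mat_4I)
      (auto simp: flip_neg_def psi_minus_def ket_def unit_vec_def numeral_2_eq_2 *,
        simp_all flip: numeral_2_eq_2)
qed

lemma trace_flip_neg_xmat:
  "Re (mat_trace (flip_neg 2 * xmat a b c d x y)) = (b + c) / 2 - x"
  unfolding flip_neg_2
  by (simp add: mat_trace_def sum_lessThan_4 scalar_prod_def atLeast0LessThan field_simps)

lemma max_ent_2_form:
  "Re ((xmat a b c d x y *\<^sub>v max_ent 2) \<bullet>c max_ent 2) = (a + d) / 2 + y"
proof -
  have c: "max_ent 2 \<in> carrier_vec 4" by (simp add: max_ent_def)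
  define k where "k = 1 / sqrt 2"
  have k: "k * (k * z) = z / 2" for z by (simp add: k_def)
  have "max_ent 2 $ 0 = k" "max_ent 2 $ Suc 0 = 0" "max_ent 2 $ 2 = 0" "max_ent 2 $ 3 = k"
    by (auto simp: max_ent_def ket_def unit_vec_def lessThan_Suc numeral_2_eq_2 numeral_3_eq_3 k_def)
  then show ?thesis
    unfolding mult_mat_vec_cscalar_prod[OF xmat_carrier c c]
    by (simp add: sum_lessThan_4 algebra_simps k)
qed

lemma negativityI: "pt_neg 2 A = xmat a b c d x y \<Longrightarrow> negativity 2 A = a + b + c + d"
  by (simp add: negativity_def trace_xmat)

lemma state_xmat:
  assumes "0 \<le> a" "0 \<le> b" "0 \<le> c" "0 \<le> d" "x\<^sup>2 \<le> b * c" "y\<^sup>2 \<le> a * d" "a + b + c + d = 1"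
  shows "state (2 * 2) (xmat a b c d x y)"
  using assms psd_xmat by (simp add: state_def trace_xmat del: of_real_add)

section \<open>The four states and their negative parts\<close>

definition noisy_max_ent :: "complex mat" where
  "noisy_max_ent = xmat (2/7) (3/7) 0 (2/7) 0 (2/7)"

text \<open>The weight 1/7 makes its negativity equal to that of \<open>noisy_max_ent\<close>, so
  \<open>W_N\<close> is exactly 0 on that pair.\<close>

definition wer_state :: "complex mat" where
  "wer_state = xmat (6/7) 0 0 (1/7) 0 (1/7)"

definition iso_state :: "complex mat" where
  "iso_state = xmat 0 (6/7) (1/7) 0 (-1/7) 0"

definition product_state :: "complex mat" where
  "product_state = xmat 1 0 0 0 0 0"

lemma states:
  "state (2 * 2) noisy_max_ent" "state (2 * 2) wer_state"
  "state (2 * 2) iso_state" "state (2 * 2) product_state"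
  unfolding noisy_max_ent_def wer_state_def iso_state_def product_state_def
  by (rule state_xmat; simp add: power2_eq_square)+

text \<open>The block with diagonal 3/7, 0 and off-diagonal 2/7 has eigenvalues 4/7 and -1/7, with
  eigenvectors (2, 1) and (1, -2); they are rational because 3^2 + 4^2 = 5^2.\<close>

lemma pt_neg_noisy_max_ent: "pt_neg 2 noisy_max_ent = xmat 0 (1/35) (4/35) 0 (-2/35) 0"
  unfolding noisy_max_ent_def
  by (rule pt_neg_xmat[where a = "2/7" and b = "16/35" and c = "4/35" and d = "2/7"
        and x = "8/35" and y = 0]) (simp_all add: power2_eq_square)

lemma pt_neg_pt_neg_noisy_max_ent:
  "pt_neg 2 (pt_neg 2 noisy_max_ent) = xmat (1/35) 0 0 (1/35) 0 (1/35)"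
  unfolding pt_neg_noisy_max_ent
  by (rule pt_neg_xmat[where a = "1/35" and b = "1/35" and c = "4/35" and d = "1/35"
        and x = 0 and y = "-1/35"]) (simp_all add: power2_eq_square)

lemma pt_neg_wer_state: "pt_neg 2 wer_state = xmat 0 (1/14) (1/14) 0 (-1/14) 0"
  unfolding wer_state_def
  by (rule pt_neg_xmat[where a = "6/7" and b = "1/14" and c = "1/14" and d = "1/7"
        and x = "1/14" and y = 0]) (simp_all add: power2_eq_square)

lemma pt_neg_iso_state: "pt_neg 2 iso_state = xmat (1/14) 0 0 (1/14) 0 (1/14)"
  unfolding iso_state_def
  by (rule pt_neg_xmat[where a = "1/14" and b = "6/7" and c = "1/7" and d = "1/14"
        and x = 0 and y = "-1/14"]) (simp_all add: power2_eq_square)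

lemma pt_neg_product_state: "pt_neg 2 product_state = xmat 0 0 0 0 0 0"
  unfolding product_state_def
  by (rule pt_neg_xmat[where a = 1 and b = 0 and c = 0 and d = 0 and x = 0 and y = 0]) simp_all

lemma pt_neg_pt_neg_product_state: "pt_neg 2 (pt_neg 2 product_state) = xmat 0 0 0 0 0 0"
  unfolding pt_neg_product_state
  by (rule pt_neg_xmat[where a = 0 and b = 0 and c = 0 and d = 0 and x = 0 and y = 0]) simp_all

lemmas negativities =
  negativityI[OF pt_neg_noisy_max_ent] negativityI[OF pt_neg_pt_neg_noisy_max_ent]
  negativityI[OF pt_neg_wer_state] negativityI[OF pt_neg_iso_state]
  negativityI[OF pt_neg_product_state] negativityI[OF pt_neg_pt_neg_product_state]

section \<open>Values of the witnesses on the four pairs\<close>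

lemma witness_noisy_wer:
  "W_N 2 2 noisy_max_ent wer_state = 0" "W_wer 2 2 noisy_max_ent wer_state = -1/70"
  by (simp_all add: W_N_def W_wer_def negativities pt_neg_wer_state trace_flip_neg_xmat)

lemma witness_noisy_iso:
  "W_N 2 2 noisy_max_ent iso_state = 0" "W_iso 2 2 noisy_max_ent iso_state = -1/70"
  by (simp_all add: W_N_def W_iso_def negativities pt_neg_iso_state max_ent_2_form)

text \<open>\<open>W_iso\<close> vanishes because \<psi>^- is orthogonal to \<Phi>.\<close>

lemma witness_product_wer:
  "W_N 2 2 product_state wer_state = -1/7" "W_wer 2 2 product_state wer_state = -1/7"
  "W_iso 2 2 product_state wer_state = 0"
  by (simp_all add: W_N_def W_wer_def W_iso_def negativities pt_neg_wer_state
      trace_flip_neg_xmat max_ent_2_form)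

lemma witness_product_iso:
  "W_N 2 2 product_state iso_state = -1/7" "W_wer 2 2 product_state iso_state = 0"
  "W_iso 2 2 product_state iso_state = -1/7"
  by (simp_all add: W_N_def W_wer_def W_iso_def negativities pt_neg_iso_state
      trace_flip_neg_xmat max_ent_2_form)

lemma not_dominatesI:
  assumes "state (2 * 2) \<rho>" "state (2 * 2) \<sigma>" "W2 2 2 \<rho> \<sigma> < 0" "0 \<le> W1 2 2 \<rho> \<sigma>"
  shows "\<not> dominates W1 W2"
  using assms unfolding dominates_def by (meson leD order_refl)

theorem proposition1:
  shows "\<not> dominates W_N W_wer \<and> \<not> dominates W_N W_iso \<and>
    \<not> dominates W_wer W_N \<and> \<not> dominates W_wer W_iso \<and>
    \<not> dominates W_iso W_N \<and> \<not> dominates W_iso W_wer"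
proof (intro conjI)
  show "\<not> dominates W_N W_wer"
    by (rule not_dominatesI[OF states(1,2)]) (simp_all add: witness_noisy_wer)
  show "\<not> dominates W_N W_iso"
    by (rule not_dominatesI[OF states(1,3)]) (simp_all add: witness_noisy_iso)
  show "\<not> dominates W_wer W_N" "\<not> dominates W_wer W_iso"
    by (rule not_dominatesI[OF states(4,3)]; simp add: witness_product_iso)+
  show "\<not> dominates W_iso W_N" "\<not> dominates W_iso W_wer"
    by (rule not_dominatesI[OF states(4,2)]; simp add: witness_product_wer)+
qed

end
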